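(* Let $\mu$ be a probability measure on a finite set $\Omega$ with the mass of the least atom equal to $\lambda\in(0,1/2)$. Then for all $1<p<2$, with $p^*=p/(p-1)$, $$ \sigma_{p,p^*}(\mu)=\sigma_{p,p^*}(\lambda)=\frac{\sinh\left(\frac{1}{p^*}\log\frac{1-\lambda}{\lambda}\right)}{\sinh\left(\frac1p\log\frac{1-\lambda}{\lambda}\right)}. $$
   Context: For a probability measure $\mu$ on a finite set $\Omega$ and $1<p<q<\infty$, $\sigma_{p,q}(\mu):=\max\{0<r<1:\ \|\mathbb{E}_\mu+r(\mathrm{Id}-\mathbb{E}_\mu)\|_{L^p(\mu)\to L^q(\mu)}\le1\}$, where $\mathbb{E}_\mu f$ denotes the constant function $\int f\,d\mu$; equivalently it is the infimum of $\sigma_{p,q}(X)$ over random variables $X$ on $\Omega$ with $\mathbb{E}_\mu(X)=0$. Here, for a real-valued random variable $X$, $\sigma_{p,q}(X)$ is the largest $r$ such that $\|1+r\rho X\|_q\le\|1+\rho X\|_p$ for all $\rho\in\mathbb{R}$. For $\lambda\in(0,1/2]$, $\sigma_{p,q}(\lambda):=\sigma_{p,q}(X_\lambda)$, where $\mathbb{P}(X_\lambda=1-\lambda)=\lambda$ and $\mathbb{P}(X_\lambda=-\lambda)=1-\lambda$. *)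

theory Defs
  imports "HOL-Probability.Probability"
begin

text \<open>The Bochner integral of a non-integrable function is 0, so the next definition is the
  usual (semi)norm only on functions whose \<open>p\<close>-th power is integrable.  On a finite probability
  space with discrete sigma-algebra this is every function.\<close>

definition lp_norm :: "'a measure \<Rightarrow> real \<Rightarrow> ('a \<Rightarrow> real) \<Rightarrow> real" where
  "lp_norm M p f = (\<integral>x. \<bar>f x\<bar> powr p \<partial>M) powr (1 / p)"

definition lp_space :: "'a measure \<Rightarrow> real \<Rightarrow> ('a \<Rightarrow> real) set" where
  "lp_space M p = {f \<in> borel_measurable M. integrable M (\<lambda>x. \<bar>f x\<bar> powr p)}"

text \<open>The supremum is taken in \<^typ>\<open>ereal\<close> so that an unbounded operator has norm \<open>\<infinity>\<close>.\<close>

definition lp_lq_opnorm ::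
    "'a measure \<Rightarrow> real \<Rightarrow> real \<Rightarrow> (('a \<Rightarrow> real) \<Rightarrow> ('a \<Rightarrow> real)) \<Rightarrow> ereal" where
  "lp_lq_opnorm M p q T = (SUP f \<in> {f \<in> lp_space M p. lp_norm M p f \<le> 1}. ereal (lp_norm M q (T f)))"

definition expect_op :: "'a measure \<Rightarrow> ('a \<Rightarrow> real) \<Rightarrow> ('a \<Rightarrow> real)" where
  "expect_op M f = (\<lambda>_. \<integral>y. f y \<partial>M)"

definition noise_op :: "'a measure \<Rightarrow> real \<Rightarrow> ('a \<Rightarrow> real) \<Rightarrow> ('a \<Rightarrow> real)" where
  "noise_op M r f = (\<lambda>x. expect_op M f x + r * (f x - expect_op M f x))"

text \<open>Both quantities below are maxima, not suprema: \<^const>\<open>Greatest\<close> is the greatest element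
  when one exists and unspecified otherwise.\<close>

definition sigma_measure :: "real \<Rightarrow> real \<Rightarrow> 'a measure \<Rightarrow> real" where
  "sigma_measure p q M = (GREATEST r. 0 < r \<and> r < 1 \<and> lp_lq_opnorm M p q (noise_op M r) \<le> 1)"

definition sigma_rv :: "real \<Rightarrow> real \<Rightarrow> 'a measure \<Rightarrow> ('a \<Rightarrow> real) \<Rightarrow> real" where
  "sigma_rv p q M X =
    (GREATEST r. \<forall>\<rho>. lp_norm M q (\<lambda>x. 1 + r * \<rho> * X x) \<le> lp_norm M p (\<lambda>x. 1 + \<rho> * X x))"

definition two_point_rv :: "real \<Rightarrow> bool \<Rightarrow> real" where
  "two_point_rv l b = (if b then 1 - l else - l)"

definition sigma_two_point :: "real \<Rightarrow> real \<Rightarrow> real \<Rightarrow> real" where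
  "sigma_two_point p q l =
    sigma_rv p q (measure_pmf (bernoulli_pmf l)) (two_point_rv l)"

text \<open>Points of measure zero are not atoms.\<close>

definition least_atom_mass :: "'a measure \<Rightarrow> real" where
  "least_atom_mass M = Min {measure M {x} | x. x \<in> space M \<and> 0 < measure M {x}}"

end

theory Submission
  imports Defs
begin

text \<open>
  The noise operator \<open>T\<^sub>r = E + r (Id - E)\<close> is \<open>T\<^sub>s T\<^sub>s\<^sup>*\<close> with \<open>s = sqrt r\<close>, so
  \<open>T\<^sub>r : L\<^sup>p \<rightarrow> L\<^bsup>p*\<^esup>\<close> is a contraction iff \<open>T\<^sub>s : L\<^sup>p \<rightarrow> L\<^sup>2\<close> is, that is, iff
  \<open>Q(f) = (1 - r) (E f)\<^sup>2 + r E f\<^sup>2 \<le> (E \<bar>f\<bar>\<^sup>p)\<^bsup>2/p\<^esup>\<close> for all \<open>f\<close>.  At a nonnegative maximiser of the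
  quotient of the two sides the Lagrange condition reads \<open>c f\<^bsup>p-1\<^esup> = d + r f\<close>; the left side is strictly
  concave in \<open>f\<close>, so \<open>f\<close> takes at most two values, on sets of mass \<open>a + b = 1\<close> with \<open>a, b \<ge> \<lambda>\<close>.
  For two values \<open>x, y\<close> put \<open>u = a\<^bsup>1/p\<^esup> x\<close> and \<open>v = b\<^bsup>1/p\<^esup> y\<close>.  The sharp constant is the \<open>r\<close> for which
  \<open>Q\<close> becomes symmetric in \<open>u\<close> and \<open>v\<close>: then equality at \<open>x = y\<close> yields, by swapping \<open>u\<close> and \<open>v\<close>, equality
  at a nonconstant function, whence optimality.
\<close>

section \<open>Monotonicity of hyperbolic quotients\<close>

text \<open>The quotient rule gives a derivative with the sign of \<open>- k\<close>, and
  \<open>k\<close> vanishes at 0 and has the nonnegative derivative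
  \<open>(d\<^sup>2 - c\<^sup>2) * sinh (c * x) * sinh (d * x)\<close>.\<close>

lemma sinh_ratio_antimono:
  fixes c d s t :: real
  assumes "0 < c" "c < d" "0 < s" "s \<le> t"
  shows "sinh (c * t) / sinh (d * t) \<le> sinh (c * s) / sinh (d * s)"
proof -
  define k where "k = (\<lambda>s. d * sinh (c * s) * cosh (d * s) - c * cosh (c * s) * sinh (d * s))"
  have k_pos: "0 \<le> k s" if "0 \<le> s" for s
  proof -
    have "k 0 \<le> k s"
    proof (rule DERIV_nonneg_imp_nondecreasing[OF that])
      fix x :: real assume x: "0 \<le> x"
      have "(k has_real_derivative (d\<^sup>2 - c\<^sup>2) * sinh (c * x) * sinh (d * x)) (at x)"
        unfolding k_def by (auto intro!: derivative_eq_intros simp: algebra_simps power2_eq_square)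
      moreover have "0 \<le> (d\<^sup>2 - c\<^sup>2) * sinh (c * x) * sinh (d * x)"
        using x assms by (intro mult_nonneg_nonneg) (auto simp: power_mono)
      ultimately show "\<exists>y. (k has_real_derivative y) (at x) \<and> 0 \<le> y" by blast
    qed
    then show ?thesis by (simp add: k_def)
  qed
  show ?thesis
  proof (rule DERIV_nonpos_imp_nonincreasing[OF \<open>s \<le> t\<close>])
    fix x :: real assume "s \<le> x"
    then have x: "0 < x" using assms by simp
    then have pos: "0 < sinh (d * x)" using assms by simp
    have "((\<lambda>x. sinh (c * x) / sinh (d * x)) has_real_derivative - k x / (sinh (d * x))\<^sup>2) (at x)"
      using pos unfolding k_def by (auto intro!: derivative_eq_intros simp: field_simps power2_eq_square)
    moreover have "- k x / (sinh (d * x))\<^sup>2 \<le> 0"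
      using k_pos[of x] x by (simp add: divide_nonpos_nonneg)
    ultimately show "\<exists>y. ((\<lambda>x. sinh (c * x) / sinh (d * x)) has_real_derivative y) (at x) \<and> y \<le> 0"
      by blast
  qed
qed

text \<open>By the subtraction formula for \<open>sinh\<close>, the derivative has the sign of
  \<open>A * sinh ((2 - p) * w) - B * sinh (p * w)\<close>. Since \<open>2 - p < p\<close>, the
  quotient of the two \<open>sinh\<close> factors decreases for positive \<open>w\<close>, so the
  function rises up to \<open>w0\<close> and falls afterwards. Negative \<open>w\<close> follow by
  evenness.\<close>

lemma cosh_quotient_max:
  fixes A B p w0 w :: real
  assumes p: "1 < p" "p < 2" and AB: "0 < A" "0 < B" and w0: "0 < w0"
    and crit: "A * sinh ((2 - p) * w0) = B * sinh (p * w0)"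
  shows "ln (A * cosh (2 * w) + B) - 2 / p * ln (cosh (p * w)) \<le>
    ln (A * cosh (2 * w0) + B) - 2 / p * ln (cosh (p * w0))"
proof -
  define h where "h = (\<lambda>w. ln (A * cosh (2 * w) + B) - 2 / p * ln (cosh (p * w)))"
  define h' where "h' = (\<lambda>w. 2 * (A * sinh ((2 - p) * w) - B * sinh (p * w)) /
     ((A * cosh (2 * w) + B) * cosh (p * w)))"
  have pos: "0 < A * cosh (2 * w) + B" for w using AB by (simp add: add_pos_pos)
  have deriv: "(h has_real_derivative h' w) (at w)" for w
  proof -
    have "(h has_real_derivative (2 * A * sinh (2 * w) / (A * cosh (2 * w) + B) - 2 * sinh (p * w) / cosh (p * w))) (at w)"
      unfolding h_def using pos[of w] p by (auto intro!: derivative_eq_intros simp: mult_ac)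
    moreover have "2 * A * sinh (2 * w) / (A * cosh (2 * w) + B) - 2 * sinh (p * w) / cosh (p * w) = h' w"
    proof -
      have e: "sinh ((2 - p) * w) = sinh (2 * w) * cosh (p * w) - cosh (2 * w) * sinh (p * w)"
        using sinh_diff[of "2 * w" "p * w"] by (simp add: left_diff_distrib)
      have "cosh (p * w) \<noteq> 0" "A * cosh (2 * w) + B \<noteq> 0" using pos[of w] by auto
      then show ?thesis unfolding h'_def e by (simp add: divide_simps) (simp add: algebra_simps)
    qed
    ultimately show ?thesis by simp
  qed
  have frac_le: "B * y \<le> A * x" if "B / A \<le> x / y" "0 < y" for x y
    using that AB by (simp add: field_simps)
  have frac_ge: "A * x \<le> B * y" if "x / y \<le> B / A" "0 < y" for x y
    using that AB by (simp add: field_simps)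
  have up: "0 \<le> h' w" if "0 \<le> w" "w \<le> w0" for w
  proof (cases "w = 0")
    case False
    with that have w: "0 < w" by simp
    have "sinh ((2 - p) * w0) / sinh (p * w0) \<le> sinh ((2 - p) * w) / sinh (p * w)"
      using p w that by (intro sinh_ratio_antimono) auto
    moreover have "sinh ((2 - p) * w0) / sinh (p * w0) = B / A"
      using crit AB w0 p by (simp add: field_simps)
    ultimately have "B * sinh (p * w) \<le> A * sinh ((2 - p) * w)"
      using frac_le AB w p by simp
    then show ?thesis unfolding h'_def using pos[of w] by (auto intro!: divide_nonneg_pos mult_pos_pos)
  qed (simp add: h'_def)
  have down: "h' w \<le> 0" if "w0 \<le> w" for w
  proof -
    have w: "0 < w" using that w0 by simp
    have "sinh ((2 - p) * w) / sinh (p * w) \<le> sinh ((2 - p) * w0) / sinh (p * w0)"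
      using p w0 that by (intro sinh_ratio_antimono) auto
    moreover have "sinh ((2 - p) * w0) / sinh (p * w0) = B / A"
      using crit AB w0 p by (simp add: field_simps)
    ultimately have "A * sinh ((2 - p) * w) \<le> B * sinh (p * w)"
      using frac_ge AB w p by simp
    then show ?thesis unfolding h'_def using pos[of w] by (auto intro!: divide_nonpos_pos mult_pos_pos)
  qed
  have nonneg: "h w \<le> h w0" if "0 \<le> w" for w
  proof (cases "w \<le> w0")
    case True
    show ?thesis
      by (rule DERIV_nonneg_imp_nondecreasing[OF True]) (use deriv up that in force)
  next
    case False
    then have "w0 \<le> w" by simp
    then show ?thesis
      by (rule DERIV_nonpos_imp_nonincreasing) (use deriv down in force)
  qed
  have "h \<bar>w\<bar> = h w" by (simp add: h_def abs_if)
  with nonneg[of "\<bar>w\<bar>"] show ?thesis by (simp add: h_def)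
qed

section \<open>The sharp two-point inequality\<close>

text \<open>The constant of the theorem, with \<open>1 - 1 / p\<close> standing for the reciprocal
  of the conjugate exponent. At \<open>l = 1 / 2\<close> the formula degenerates to
  \<open>0 / 0\<close>.\<close>

definition hyper_const :: "real \<Rightarrow> real \<Rightarrow> real" where
  "hyper_const p l = sinh ((1 - 1 / p) * ln ((1 - l) / l)) / sinh (1 / p * ln ((1 - l) / l))"

text \<open>This is where the value of \<open>r\<close> enters: after multiplication by
  \<open>E - 1 / E\<close> the coefficients of \<open>W\<close> and \<open>1 / W\<close> on the left
  both become \<open>F\<^sup>2 - 1 / F\<^sup>2\<close>, so the form is invariant under exchanging
  \<open>W\<close> and \<open>1 / W\<close>. In the application \<open>E = exp (t / p)\<close>,
  \<open>F = exp (t / 2)\<close> and \<open>W = exp (2 * w)\<close>.\<close>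

lemma two_point_form_identity:
  fixes E F W r :: real
  assumes "1 < E" "0 < F" "0 < W" and r: "r = (F\<^sup>2 / E - E / F\<^sup>2) / (E - 1 / E)"
  shows "F * (F + r / F) * (W / E) + 1 / F * (1 / F + r * F) * (E / W) + 2 * (1 - r) =
    2 * (F + 1 / F) / (E - 1 / E) * ((F - 1 / F) * (W + 1 / W) / 2 + (E / F - F / E))"
proof -
  have nz: "E \<noteq> 0" "F \<noteq> 0" "W \<noteq> 0" using assms by auto
  define S where "S = E - 1 / E"
  have "1 < E * E" using assms by (simp add: less_1_mult)
  then have S: "S \<noteq> 0" using assms by (simp add: S_def field_simps)
  have rS: "r * S = F\<^sup>2 / E - E / F\<^sup>2" using S r by (simp add: S_def)
  have "(F * (F + r / F) * (W / E) + 1 / F * (1 / F + r * F) * (E / W) + 2 * (1 - r)) * S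
    = (F\<^sup>2 * S + r * S) * (W / E) + (S / F\<^sup>2 + r * S) * (E / W) + 2 * (S - r * S)"
    using nz by (simp add: field_simps power2_eq_square)
  also have "\<dots> = 2 * (F + 1 / F) * ((F - 1 / F) * (W + 1 / W) / 2 + (E / F - F / E))"
    unfolding rS unfolding S_def using nz by (simp add: field_simps power2_eq_square)
  finally show ?thesis using S unfolding S_def[symmetric] by (simp add: field_simps)
qed

text \<open>The variable \<open>w\<close> is \<open>ln (u/v) / 2\<close>; constant functions sit at \<open>w = t / (2p)\<close>, and the
  symmetry of the form is evenness in \<open>w\<close>.\<close>

lemma two_point_substitution:
  fixes a b p s w t r :: real
  assumes p: "1 < p" and ab: "0 < b" "b < a" "a + b = 1"
    and t: "t = ln (a / b)" and r: "r = hyper_const p b"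
    and x: "x = exp (s + w - t / (2 * p))" and y: "y = exp (s - w + t / (2 * p))"
  shows "a * x powr p + b * y powr p = exp (p * s) * (cosh (p * w) / cosh (t / 2))" (is ?th1)
    and "(1 - r) * (a * x + b * y)\<^sup>2 + r * (a * x\<^sup>2 + b * y\<^sup>2) =
      exp (2 * s) * (sinh (t / 2) * cosh (2 * w) + sinh (t / p - t / 2)) / (sinh (t / p) * cosh (t / 2))" (is ?th2)
proof -
  have t0: "0 < t" using ab unfolding t by simp
  \<comment> \<open>The masses are \<open>m * exp (t / 2)\<close> and
    \<open>m * exp (- (t / 2))\<close>; these exponentials cancel against the shifts by
    \<open>t / (2 * p)\<close> in \<open>x\<close> and \<open>y\<close> once those are raised to the
    power \<open>p\<close>.\<close>
  define m where "m = 1 / (2 * cosh (t / 2))"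
  have m0: "0 < m" by (simp add: m_def)
  have et: "exp t = a / b" using ab t by simp
  have ha: "a = m * exp (t / 2)" and hb: "b = m * exp (- (t / 2))"
  proof -
    have c: "2 * cosh (t / 2) = exp (t/2) * (1 + exp (-t))" "2 * cosh (t / 2) = exp (-(t/2)) * (1 + exp t)"
      by (simp_all add: cosh_field_def distrib_left flip: exp_add)
    have "1 + exp (-t) = (a + b) / a" "1 + exp t = (a + b) / b"
      using ab(1,2) et by (simp_all add: exp_minus add_divide_distrib)
    note e = this
    show "a = m * exp (t / 2)" unfolding m_def c(1) e using ab by simp
    show "b = m * exp (- (t / 2))" unfolding m_def c(2) e using ab by simp
  qed
  have "a * x powr p + b * y powr p =
     m * (exp (t / 2) * exp (p * (s + w - t / (2 * p))) + exp (- (t / 2)) * exp (p * (s - w + t / (2 * p))))"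
    unfolding x y ha hb by (simp add: powr_def algebra_simps)
  also have "exp (t / 2) * exp (p * (s + w - t / (2 * p))) = exp (p * s) * exp (p * w)"
    using p by (simp add: field_simps flip: exp_add)
  also have "exp (- (t / 2)) * exp (p * (s - w + t / (2 * p))) = exp (p * s) * exp (- (p * w))"
    using p by (simp add: field_simps flip: exp_add)
  finally show ?th1 by (simp add: m_def cosh_field_def field_simps)
  define E where "E = exp (t / p)"
  define F where "F = exp (t / 2)"
  define W where "W = exp (2 * w)"
  have sE: "sinh (t / p) = (E - 1 / E) / 2" by (simp add: sinh_field_def E_def exp_minus inverse_eq_divide)
  have sF: "sinh (t / 2) = (F - 1 / F) / 2" by (simp add: sinh_field_def F_def exp_minus inverse_eq_divide)
  have cF: "cosh (t / 2) = (F + 1 / F) / 2" by (simp add: cosh_field_def F_def exp_minus inverse_eq_divide)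
  have cW: "cosh (2 * w) = (W + 1 / W) / 2" by (simp add: cosh_field_def W_def exp_minus inverse_eq_divide)
  have sEF: "sinh (t / p - t / 2) = (E / F - F / E) / 2"
    by (simp add: sinh_field_def E_def F_def exp_diff)
  have F2: "F\<^sup>2 = exp t" by (simp add: F_def power2_eq_square flip: exp_add)
  have "sinh ((1 - 1 / p) * t) = sinh (t - t / p)" by (simp add: algebra_simps)
  also have "\<dots> = (F\<^sup>2 / E - E / F\<^sup>2) / 2"
    unfolding F2 by (simp add: sinh_field_def E_def exp_diff)
  finally have rE: "r = (F\<^sup>2 / E - E / F\<^sup>2) / (E - 1 / E)"
  proof -
    assume *: "sinh ((1 - 1 / p) * t) = (F\<^sup>2 / E - E / F\<^sup>2) / 2"
    have "1 - b = a" using ab by simp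
    then have "r = sinh ((1 - 1 / p) * t) / sinh (t / p)" by (simp add: r hyper_const_def t)
    moreover have "(X / 2) / (Y / 2) = X / Y" for X Y :: real by simp
    ultimately show ?thesis unfolding * sE by (simp only:)
  qed
  have pos: "1 < E" "0 < F" "0 < W" using p t0 by (auto simp: E_def F_def W_def)
  have halves: "2 * P / S * (X * V / 2 + D) = 4 * (P / 2) / (S / 2) * (X / 2 * (V / 2) + D / 2)"
    for P S X V D :: real by (simp add: algebra_simps)
  have sx: "x\<^sup>2 = exp (2 * s) * (W / E)"
    unfolding x E_def W_def by (simp add: power2_eq_square flip: exp_add exp_diff)
  have sy: "y\<^sup>2 = exp (2 * s) * (E / W)"
    unfolding y E_def W_def by (simp add: power2_eq_square flip: exp_add exp_diff)
  have sxy: "x * y = exp (2 * s)" unfolding x y by (simp flip: exp_add)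
  have hF: "a = m * F" "b = m / F" using ha hb by (auto simp: F_def exp_minus inverse_eq_divide)
  \<comment> \<open>The inserted factor \<open>a + b = 1\<close> makes the expression homogeneous of
    degree two in the masses, so that \<open>m\<^sup>2\<close> factors out.\<close>
  have "(1 - r) * (a * x + b * y)\<^sup>2 + r * (a * x\<^sup>2 + b * y\<^sup>2) =
     (1 - r) * (a * x + b * y)\<^sup>2 + r * (a + b) * (a * x\<^sup>2 + b * y\<^sup>2)"
    using ab by simp
  also have "\<dots> = a * (a + r * b) * x\<^sup>2 + b * (b + r * a) * y\<^sup>2 + 2 * (1 - r) * (a * b) * (x * y)"
    by (simp add: algebra_simps power2_eq_square)
  also have "\<dots> = exp (2 * s) * m\<^sup>2 * (F * (F + r / F) * (W / E) + 1 / F * (1 / F + r * F) * (E / W) + 2 * (1 - r))"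
    unfolding sx sy sxy hF using pos by (simp add: field_simps power2_eq_square)
  also have "\<dots> = exp (2 * s) * m\<^sup>2 * (2 * (F + 1 / F) / (E - 1 / E) * ((F - 1 / F) * (W + 1 / W) / 2 + (E / F - F / E)))"
    by (subst two_point_form_identity[OF pos rE]) simp
  also have "\<dots> = exp (2 * s) * m\<^sup>2 * (4 * cosh (t / 2) / sinh (t / p) * (sinh (t / 2) * cosh (2 * w) + sinh (t / p - t / 2)))"
    unfolding sE sF cF cW sEF halves ..
  also have "\<dots> = exp (2 * s) * (sinh (t / 2) * cosh (2 * w) + sinh (t / p - t / 2)) / (sinh (t / p) * cosh (t / 2))"
    using cosh_real_pos[of "t/2"] by (simp add: m_def power2_eq_square)
  finally show ?th2 .
qed

text \<open>The constant decreases in \<open>t = ln ((1 - l) / l)\<close>, and \<open>t\<close>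
  decreases in \<open>l\<close>, so the constant increases with the mass. The least atom therefore
  gives the worst constant.\<close>

lemma hyper_const_antimono:
  assumes p: "1 < p" "p < 2" and l: "0 < l" "l \<le> a" "a < 1 / 2"
  shows "hyper_const p l \<le> hyper_const p a"
proof -
  have "(1 - a) / a \<le> (1 - l) / l" "1 < (1 - a) / a" using l by (auto simp: field_simps)
  then have t: "0 < ln ((1 - a) / a)" "ln ((1 - a) / a) \<le> ln ((1 - l) / l)"
    using l by auto
  have "0 < 1 - 1 / p" "1 - 1 / p < 1 / p" using p by (auto simp: field_simps)
  then show ?thesis unfolding hyper_const_def by (intro sinh_ratio_antimono t)
qed

lemma hyper_const_bounds:
  assumes p: "1 < p" "p < 2" and l: "0 < l" "l < 1 / 2"
  shows "0 < hyper_const p l" "hyper_const p l < 1"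
proof -
  have "1 < (1 - l) / l" using l by (auto simp: field_simps)
  then have t: "0 < ln ((1 - l) / l)" by simp
  have "0 < 1 - 1 / p" "1 - 1 / p < 1 / p" using p by (auto simp: field_simps)
  then have "0 < (1 - 1 / p) * ln ((1 - l) / l)"
      "(1 - 1 / p) * ln ((1 - l) / l) < 1 / p * ln ((1 - l) / l)"
    using t by (intro mult_pos_pos mult_strict_right_mono; simp)+
  moreover from this have "0 < sinh (1 / p * ln ((1 - l) / l))"
    by (simp only: sinh_real_pos_iff)
  ultimately show "0 < hyper_const p l" "hyper_const p l < 1"
    unfolding hyper_const_def by (simp_all only: divide_pos_pos sinh_real_pos_iff divide_less_eq_1_pos sinh_real_less_iff)
qed

text \<open>After the substitution the scale \<open>s\<close> drops out, and what must be bounded is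
  \<open>Q w / N w powr (2 / p)\<close>. Constant functions sit at \<open>w0\<close>, where
  \<open>Q\<close> and \<open>N\<close> are both 1, and \<open>w0\<close> is the maximum
  point.\<close>

lemma two_point_inequality_own_const:
  fixes a b p x y r :: real
  assumes p: "1 < p" "p < 2" and ab: "0 < b" "b < a" "a + b = 1" and xy: "0 < x" "0 < y"
  defines "r \<equiv> hyper_const p b"
  shows "(1 - r) * (a * x + b * y)\<^sup>2 + r * (a * x\<^sup>2 + b * y\<^sup>2) \<le> (a * x powr p + b * y powr p) powr (2 / p)"
proof -
  define t where "t = ln (a / b)"
  have t0: "0 < t" using ab unfolding t_def by simp
  define s where "s = (ln x + ln y) / 2"
  define w where "w = (ln x - ln y) / 2 + t / (2 * p)"
  define w0 where "w0 = t / (2 * p)"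
  define A B where "A = sinh (t / 2)" and "B = sinh (t / p - t / 2)"
  define Q where "Q = (\<lambda>w. (A * cosh (2 * w) + B) / (sinh (t / p) * cosh (t / 2)))"
  define N where "N = (\<lambda>w. cosh (p * w) / cosh (t / 2))"
  have "t / 2 < t / p" using p t0 by (simp add: field_simps)
  then have AB: "0 < A" "0 < B" using t0 by (auto simp: A_def B_def)
  have x: "x = exp (s + w - t / (2 * p))" and y: "y = exp (s - w + t / (2 * p))"
    using xy by (auto simp: s_def w_def field_simps)
  note sub = two_point_substitution[OF p(1) ab t_def meta_eq_to_obj_eq[OF r_def]]
  have e1: "(1 - r) * (a * x + b * y)\<^sup>2 + r * (a * x\<^sup>2 + b * y\<^sup>2) = exp (2 * s) * Q w"
    using sub(2)[OF x y] by (simp add: Q_def A_def B_def)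
  have e2: "a * x powr p + b * y powr p = exp (p * s) * N w"
    using sub(1)[OF x y] by (simp add: N_def)
  have one: "1 = exp (0 + w0 - t / (2 * p))" "1 = exp (0 - w0 + t / (2 * p))"
    by (simp_all add: w0_def)
  have "(1 - r) * (a * 1 + b * 1)\<^sup>2 + r * (a * 1\<^sup>2 + b * 1\<^sup>2) = Q w0"
    unfolding sub(2)[OF one] by (simp add: Q_def A_def B_def)
  then have Q1: "Q w0 = 1" using ab by simp
  have N1: "N w0 = 1"
    using sub(1)[OF one] ab by (simp add: N_def)
  have Qpos: "0 < Q w" for w unfolding Q_def using AB t0 p
    by (auto intro!: divide_pos_pos add_pos_pos mult_pos_pos)
  have Npos: "0 < N w" for w unfolding N_def by simp
  \<comment> \<open>Both sides equal \<open>A * B\<close>, since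
    \<open>(2 - p) * w0 = t / p - t / 2\<close> and \<open>p * w0 = t / 2\<close>.\<close>
  have crit: "A * sinh ((2 - p) * w0) = B * sinh (p * w0)"
  proof -
    have "(2 - p) * w0 = t / p - t / 2" "p * w0 = t / 2" using p by (auto simp: w0_def field_simps)
    then show ?thesis by (simp add: A_def B_def)
  qed
  have w0: "0 < w0" using t0 p by (simp add: w0_def)
  have lnQ: "ln (Q w) = ln (A * cosh (2 * w) + B) - ln (sinh (t / p) * cosh (t / 2))" for w
    unfolding Q_def using AB t0 p by (intro ln_divide_pos) (auto intro!: add_pos_pos mult_pos_pos)
  have lnN: "ln (N w) = ln (cosh (p * w)) - ln (cosh (t / 2))" for w
    unfolding N_def by (intro ln_divide_pos) auto
  have "ln (Q w) - 2 / p * ln (N w) \<le> ln (Q w0) - 2 / p * ln (N w0)"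
    using cosh_quotient_max[OF p AB w0 crit, of w] unfolding lnQ lnN by (simp add: algebra_simps)
  then have "ln (Q w) \<le> 2 / p * ln (N w)" by (simp add: Q1 N1)
  then have "Q w \<le> exp (2 / p * ln (N w))" using Qpos[of w] by (metis exp_le_cancel_iff exp_ln)
  also have "\<dots> = N w powr (2 / p)" using Npos[of w] by (simp add: powr_def)
  finally have "exp (2 * s) * Q w \<le> exp (2 * s) * N w powr (2 / p)" by simp
  also have "\<dots> = (exp (p * s) * N w) powr (2 / p)"
    using Npos[of w] p by (simp add: powr_def ln_mult add_divide_distrib distrib_left exp_add)
  finally show ?thesis unfolding e1 e2 .
qed

text \<open>These values belong to \<open>w = - w0\<close>, the mirror image of the constant
  function 1 at \<open>w0\<close>, and both sides are even in \<open>w\<close>. Put differently,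
  \<open>a * x powr p = b\<close> and \<open>b * y powr p = a\<close>.\<close>

lemma two_point_equality:
  fixes a b p r :: real
  assumes p: "1 < p" and ab: "0 < b" "b < a" "a + b = 1"
  defines "r \<equiv> hyper_const p b" and "x \<equiv> (b / a) powr (1 / p)" and "y \<equiv> (a / b) powr (1 / p)"
  shows "(1 - r) * (a * x + b * y)\<^sup>2 + r * (a * x\<^sup>2 + b * y\<^sup>2) = 1"
    and "a * x powr p + b * y powr p = 1"
proof -
  define t where "t = ln (a / b)"
  have t0: "0 < t" using ab unfolding t_def by simp
  have nt: "ln (b / a) = - t" using ab by (simp add: t_def ln_div)
  define w0 where "w0 = t / (2 * p)"
  note sub = two_point_substitution[OF p(1) ab t_def meta_eq_to_obj_eq[OF r_def]]
  have one: "1 = exp (0 + w0 - t / (2 * p))" "1 = exp (0 - w0 + t / (2 * p))"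
    by (simp_all add: w0_def)
  have x: "x = exp (0 + (- w0) - t / (2 * p))" 
    using ab p unfolding x_def powr_def nt by (simp add: w0_def field_simps)
  have y: "y = exp (0 - (- w0) + t / (2 * p))"
    using ab p unfolding y_def powr_def t_def[symmetric] by (simp add: w0_def field_simps)
  have "(1 - r) * (a * x + b * y)\<^sup>2 + r * (a * x\<^sup>2 + b * y\<^sup>2) =
      (1 - r) * (a * 1 + b * 1)\<^sup>2 + r * (a * 1\<^sup>2 + b * 1\<^sup>2)"
    unfolding sub(2)[OF x y] sub(2)[OF one] by simp
  then show "(1 - r) * (a * x + b * y)\<^sup>2 + r * (a * x\<^sup>2 + b * y\<^sup>2) = 1"
    using ab by simp
  have "a * x powr p + b * y powr p = a * 1 powr p + b * 1 powr p"
    unfolding sub(1)[OF x y] sub(1)[OF one] by simp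
  then show "a * x powr p + b * y powr p = 1"
    using ab by simp
qed

text \<open>The form equals \<open>(a * x + b * y)\<^sup>2 + r * (a * b * (x - y)\<^sup>2)\<close>,
  which grows with \<open>r\<close>, and the constant of \<open>l\<close> is at most that of
  \<open>b\<close>.\<close>

lemma two_point_inequality_less_half:
  fixes a b p l x y r :: real
  assumes p: "1 < p" "p < 2" and l: "0 < l" "l \<le> b" "b < 1 / 2" and a: "a = 1 - b" and xy: "0 < x" "0 < y"
    and r: "r = hyper_const p l"
  shows "(1 - r) * (a * x + b * y)\<^sup>2 + r * (a * x\<^sup>2 + b * y\<^sup>2) \<le> (a * x powr p + b * y powr p) powr (2 / p)"
proof -
  have eq: "(1 - r) * (a * x + b * y)\<^sup>2 + r * (a * x\<^sup>2 + b * y\<^sup>2) = (a * x + b * y)\<^sup>2 + r * (a * b * (x - y)\<^sup>2)" for r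
    unfolding a by (simp add: algebra_simps power2_eq_square)
  have "r * (a * b * (x - y)\<^sup>2) \<le> hyper_const p b * (a * b * (x - y)\<^sup>2)"
    unfolding r using hyper_const_antimono[OF p l] l a by (intro mult_right_mono) auto
  moreover have "(1 - hyper_const p b) * (a * x + b * y)\<^sup>2 + hyper_const p b * (a * x\<^sup>2 + b * y\<^sup>2) \<le> (a * x powr p + b * y powr p) powr (2 / p)"
    using l a by (intro two_point_inequality_own_const p xy) auto
  ultimately show ?thesis unfolding eq by linarith
qed

lemma two_point_inequality:
  fixes a b p l x y r :: real
  assumes p: "1 < p" "p < 2" and l: "0 < l" "l < 1 / 2" "l \<le> a" "l \<le> b" and ab: "a + b = 1" and xy: "0 < x" "0 < y"
    and r: "r = hyper_const p l"
  shows "(1 - r) * (a * x + b * y)\<^sup>2 + r * (a * x\<^sup>2 + b * y\<^sup>2) \<le> (a * x powr p + b * y powr p) powr (2 / p)"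
proof -
  consider "b < 1 / 2" | "a < 1 / 2" | "a = 1 / 2" "b = 1 / 2" using ab by linarith
  then show ?thesis
  proof cases
    case 1
    then show ?thesis using assms by (intro two_point_inequality_less_half[OF p, of l]) auto
  next
    case 2
    then show ?thesis using two_point_inequality_less_half[OF p, of l a b y x r] assms by (simp add: add.commute)
  next
    case 3
    \<comment> \<open>At equal masses the constant belonging to \<open>b\<close> itself degenerates;
      instead \<open>b\<close> tends to \<open>1 / 2\<close> from below while \<open>r\<close> stays
      fixed at the constant of \<open>l < 1 / 2\<close>.\<close>
    define F where "F = (\<lambda>b. (1 - r) * ((1 - b) * x + b * y)\<^sup>2 + r * ((1 - b) * x\<^sup>2 + b * y\<^sup>2))"
    define G where "G = (\<lambda>b. ((1 - b) * x powr p + b * y powr p) powr (2 / p))"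
    have "(F \<longlongrightarrow> F (1 / 2)) (at_left (1 / 2))"
      unfolding F_def by (intro tendsto_intros)
    moreover have "(G \<longlongrightarrow> G (1 / 2)) (at_left (1 / 2))"
    proof -
      have "0 < x powr p" "0 < y powr p" using xy by auto
      then have "0 < (1 - 1 / 2) * x powr p + 1 / 2 * y powr p"
        by (intro add_pos_pos mult_pos_pos) simp_all
      then have "(1 - 1 / 2) * x powr p + 1 / 2 * y powr p \<noteq> 0" by (rule less_imp_neq[symmetric])
      then show ?thesis unfolding G_def by (intro tendsto_intros disjI1)
    qed
    moreover have "\<forall>\<^sub>F b in at_left (1 / 2). F b \<le> G b"
      using eventually_at_left[of l "1/2"] l p xy r unfolding F_def G_def
      by (auto intro!: two_point_inequality_less_half exI[of _ l])
    ultimately have "F (1 / 2) \<le> G (1 / 2)" by (intro tendsto_le[of "at_left (1 / 2)" G _ F]) auto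
    then show ?thesis by (simp add: F_def G_def 3)
  qed
qed

section \<open>Extremal functions on a finite space\<close>

text \<open>At 0 the difference quotient has modulus \<open>\<bar>h\<bar> powr (p - 1)\<close>,
  which tends to 0. Including this point permits differentiation at a maximiser before its values
  are known to be nonzero.\<close>

lemma has_real_derivative_abs_powr:
  fixes x p :: real
  assumes "1 < p"
  shows "((\<lambda>x. \<bar>x\<bar> powr p) has_real_derivative p * sgn x * \<bar>x\<bar> powr (p - 1)) (at x)"
proof -
  consider "0 < x" | "x < 0" | "x = 0" by linarith
  then show ?thesis
  proof cases
    case 1
    have "((\<lambda>x. x powr p) has_real_derivative p * x powr (p - 1)) (at x)"
      using 1 by (rule has_real_derivative_powr)
    then show ?thesis
      using 1 by (auto simp: has_field_derivative_def intro: has_derivative_transform_within_open[of _ _ _ _ "{0<..}"])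
  next
    case 2
    have "((\<lambda>x. (- x) powr p) has_real_derivative - (p * (- x) powr (p - 1))) (at x)"
      using 2 by (auto intro!: derivative_eq_intros)
    then show ?thesis
      using 2 by (auto simp: has_field_derivative_def intro: has_derivative_transform_within_open[of _ _ _ _ "{..<0}"])
  next
    case 3
    have "((\<lambda>h. \<bar>h\<bar> powr (p - 1)) \<longlongrightarrow> 0) (at (0::real))"
      using assms by (intro tendsto_eq_intros) auto
    moreover have "\<forall>\<^sub>F h in at 0. norm (\<bar>h\<bar> powr p / h) = \<bar>h\<bar> powr (p - 1)"
      by (rule eventually_at_filter[THEN iffD2]) (auto simp: powr_diff)
    ultimately have "((\<lambda>h. norm (\<bar>h\<bar> powr p / h)) \<longlongrightarrow> 0) (at (0::real))"
      by (rule tendsto_cong[THEN iffD2, rotated])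
    then have "((\<lambda>h. \<bar>h\<bar> powr p / h) \<longlongrightarrow> 0) (at (0::real))"
      by (rule tendsto_norm_zero_cancel)
    then show ?thesis using 3 assms by (simp add: DERIV_def)
  qed
qed

text \<open>Rolle's theorem between consecutive roots yields two zeros of \<open>h'\<close>, whereas
  \<open>v powr (p - 2)\<close> is strictly decreasing because \<open>p < 2\<close>.\<close>

lemma powr_affine_three_roots:
  fixes p c d r x y z :: real
  assumes p: "1 < p" "p < 2" and c: "0 < c" "0 < r" and x: "0 < x" "x < y" "y < z"
    and eq: "c * x powr (p - 1) = d + r * x" "c * y powr (p - 1) = d + r * y" "c * z powr (p - 1) = d + r * z"
  shows False
proof -
  define h where "h = (\<lambda>v. c * v powr (p - 1) - r * v)"
  define h' where "h' = (\<lambda>v. c * ((p - 1) * v powr (p - 2)) - r)"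
  have deriv: "(h has_real_derivative h' v) (at v)" if "0 < v" for v
    unfolding h_def h'_def using that by (auto intro!: derivative_eq_intros)
  have rolle: "\<exists>\<xi>>u. \<xi> < v \<and> h' \<xi> = 0" if "0 < u" "u < v" "h u = h v" for u v
    using MVT2[of u v h h'] deriv that by fastforce
  have "h x = d" "h y = d" "h z = d" using eq by (auto simp: h_def)
  then obtain u v where uv: "x < u" "u < y" "h' u = 0" "y < v" "v < z" "h' v = 0"
    using rolle[of x y] rolle[of y z] x by auto
  then have "c * ((p - 1) * u powr (p - 2)) = c * ((p - 1) * v powr (p - 2))"
    unfolding h'_def by linarith
  then have "u powr (p - 2) = v powr (p - 2)" using c p by simp
  moreover have "v powr (p - 2) < u powr (p - 2)"
    using uv x p by (intro powr_less_mono2_neg) auto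
  ultimately show False by simp
qed

lemma has_real_derivative_quadratic:
  fixes a u r D E x :: real
  shows "((\<lambda>v. a * (u * v + D)\<^sup>2 + r * (u * v\<^sup>2 + E)) has_real_derivative
    a * (2 * (u * x + D) * u) + r * (u * (2 * x))) (at x)"
  by (rule DERIV_cong, (rule derivative_intros)+) (simp add: algebra_simps)

text \<open>Both sides are homogeneous of degree two, so their quotient can be maximised over a
  compact simplex. The maximiser is positive with at most two values, and the two-point inequality
  bounds the quotient there.\<close>

lemma finite_lp_l2_inequality:
  fixes w f :: "'a \<Rightarrow> real"
  assumes p: "1 < p" "p < 2" and S: "finite S" and l: "0 < l" "l < 1 / 2"
    and w: "\<And>x. x \<in> S \<Longrightarrow> l \<le> w x" "sum w S = 1" and r: "r = hyper_const p l"
  shows "(1 - r) * (\<Sum>x\<in>S. w x * f x)\<^sup>2 + r * (\<Sum>x\<in>S. w x * (f x)\<^sup>2) \<le>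
    (\<Sum>x\<in>S. w x * \<bar>f x\<bar> powr p) powr (2 / p)"
proof -
  define Q where "Q = (\<lambda>f. (1 - r) * (\<Sum>x\<in>S. w x * f x)\<^sup>2 + r * (\<Sum>x\<in>S. w x * (f x)\<^sup>2))"
  define N where "N = (\<lambda>f. \<Sum>x\<in>S. w x * \<bar>f x\<bar> powr p)"
  have wpos: "0 < w x" if "x \<in> S" for x using w l that by force
  have r01: "0 < r" "r < 1" using hyper_const_bounds p l r by auto
  have S0: "S \<noteq> {}" using w(2) by auto
  \<comment> \<open>Requiring the value 0 off \<open>S\<close> makes \<open>K\<close> compact in the
    product topology on all functions, even when the type of points is infinite.\<close>
  define K where "K = {f. (\<forall>x. f x \<in> (if x \<in> S then {0..1} else {0::real})) \<and> sum f S = 1}"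
  have Kpos: "\<exists>x\<in>S. 0 < f x" if "f \<in> K" for f
  proof (rule ccontr)
    assume "\<not> (\<exists>x\<in>S. 0 < f x)"
    then have "sum f S \<le> 0" by (intro sum_nonpos) (auto simp: not_less)
    with that show False by (simp add: K_def)
  qed
  have Kge: "0 \<le> f x" if "f \<in> K" "x \<in> S" for f x
    using that by (auto simp: K_def split: if_splits dest: spec[of _ x])
  have Npos: "0 < N f" if "x \<in> S" "f x \<noteq> 0" for f x
    unfolding N_def using that wpos S less_imp_le[OF wpos] by (intro sum_pos2[of _ x]) auto
  have meanpos: "0 < (\<Sum>x\<in>S. w x * f x)" if "f \<in> K" for f
  proof -
    obtain x where "x \<in> S" "0 < f x" using Kpos[OF \<open>f \<in> K\<close>] by auto
    then show ?thesis using \<open>f \<in> K\<close> wpos Kge[OF \<open>f \<in> K\<close>] S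
      by (intro sum_pos2[of _ x]) (auto simp: less_imp_le)
  qed
  have NposK: "0 < N f" if "f \<in> K" for f
  proof -
    obtain x where "x \<in> S" "0 < f x" using Kpos[OF \<open>f \<in> K\<close>] by blast
    then show ?thesis using Npos[of x f] by simp
  qed
  have "compact K"
  proof -
    have "compactin (product_topology (\<lambda>_. euclidean) UNIV) (PiE UNIV (\<lambda>x. if x \<in> S then {0..1} else {0::real}))"
      by (subst compactin_PiE) auto
    then have "compact (PiE UNIV (\<lambda>x. if x \<in> S then {0..1} else {0::real}))"
      by (simp add: euclidean_product_topology)
    moreover have "closed {f :: 'a \<Rightarrow> real. sum f S = 1}"
      by (intro closed_Collect_eq continuous_on_sum continuous_on_product_coordinates continuous_on_const)
    ultimately have "compact (PiE UNIV (\<lambda>x. if x \<in> S then {0..1} else {0::real}) \<inter> {f. sum f S = 1})"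
      by (rule compact_Int_closed)
    also have "PiE UNIV (\<lambda>x. if x \<in> S then {0..1} else {0::real}) \<inter> {f. sum f S = 1} = K"
      by (auto simp: K_def PiE_def Pi_def)
    finally show ?thesis .
  qed
  moreover have "K \<noteq> {}"
  proof -
    obtain x where "x \<in> S" using S0 by auto
    then have "(\<lambda>y. if y = x then 1 else 0) \<in> K" using S by (auto simp: K_def)
    then show ?thesis by auto
  qed
  moreover have "continuous_on K (\<lambda>f. Q f / N f powr (2 / p))"
  proof -
    have "continuous_on K N" unfolding N_def
      using p by (intro continuous_intros continuous_on_powr' continuous_on_product_then_coordinatewise[OF continuous_on_id]) auto
    moreover have "continuous_on K Q" unfolding Q_def
      by (intro continuous_intros continuous_on_product_then_coordinatewise[OF continuous_on_id])
    ultimately show ?thesis using NposK by (intro continuous_on_divide continuous_on_powr continuous_on_const) (auto simp: less_imp_neq[symmetric])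
  qed
  ultimately obtain f0 where f0: "f0 \<in> K" "\<And>g. g \<in> K \<Longrightarrow> Q g / N g powr (2 / p) \<le> Q f0 / N f0 powr (2 / p)"
    using continuous_attains_sup[of K] by blast
  define M where "M = Q f0 / N f0 powr (2 / p)"
  note N0 = NposK[OF f0(1)]
  have Mpos: "0 < M"
  proof -
    have "0 < (1 - r) * (\<Sum>x\<in>S. w x * f0 x)\<^sup>2" using meanpos[OF f0(1)] r01 by simp
    moreover have "0 \<le> r * (\<Sum>x\<in>S. w x * (f0 x)\<^sup>2)"
      using r01 wpos by (intro mult_nonneg_nonneg sum_nonneg) (auto simp: less_imp_le)
    ultimately show ?thesis unfolding M_def Q_def using N0 by simp
  qed
  \<comment> \<open>A general \<open>g\<close> is replaced by its absolute value, which cannot lower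
    \<open>Q\<close> because \<open>0 < r < 1\<close>, and then divided by the sum \<open>c\<close>
    of its values to land in \<open>K\<close>.\<close>
  have max: "Q g \<le> M * N g powr (2 / p)" for g
  proof (cases "\<exists>x\<in>S. g x \<noteq> 0")
    case False
    then show ?thesis using Mpos p by (auto simp: Q_def N_def)
  next
    case True
    define c where "c = (\<Sum>x\<in>S. \<bar>g x\<bar>)"
    obtain x where x: "x \<in> S" "g x \<noteq> 0" using True by auto
    have c: "0 < c" unfolding c_def using x S by (intro sum_pos2[of _ x]) auto
    define g' where "g' = (\<lambda>x. if x \<in> S then \<bar>g x\<bar> / c else 0)"
    have "\<bar>g y\<bar> \<le> c" if "y \<in> S" for y
      unfolding c_def using that S by (intro member_le_sum) auto
    then have "g' \<in> K" using c
      by (auto simp: K_def g'_def c_def[symmetric] simp flip: sum_divide_distrib)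
    have Ng': "0 < N g'" using Npos[of x g'] x c by (auto simp: g'_def)
    have "Q g' \<le> M * N g' powr (2 / p)"
      using f0(2)[OF \<open>g' \<in> K\<close>] Ng' unfolding M_def[symmetric] by (simp add: pos_divide_le_eq)
    then have *: "c\<^sup>2 * Q g' \<le> c\<^sup>2 * (M * N g' powr (2 / p))" by (intro mult_left_mono) auto
    have abs: "\<bar>g y\<bar> = c * g' y" if "y \<in> S" for y using that c by (simp add: g'_def)
    have sq: "(g y)\<^sup>2 = c\<^sup>2 * (g' y)\<^sup>2" if "y \<in> S" for y
      using arg_cong[OF abs[OF that], of "\<lambda>v. v\<^sup>2"] by (simp add: power_mult_distrib)
    have "\<bar>\<Sum>x\<in>S. w x * g x\<bar> \<le> (\<Sum>x\<in>S. \<bar>w x * g x\<bar>)" by (rule sum_abs)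
    also have "\<dots> = c * (\<Sum>x\<in>S. w x * g' x)"
      using wpos by (auto simp: sum_distrib_left abs_mult abs less_imp_le mult_ac intro!: sum.cong)
    finally have "(\<Sum>x\<in>S. w x * g x)\<^sup>2 \<le> (c * (\<Sum>x\<in>S. w x * g' x))\<^sup>2"
      using power_mono[OF _ abs_ge_zero, of _ _ 2] by fastforce
    moreover have "(\<Sum>x\<in>S. w x * (g x)\<^sup>2) = c\<^sup>2 * (\<Sum>x\<in>S. w x * (g' x)\<^sup>2)"
      unfolding sum_distrib_left
      by (rule sum.cong) (simp_all add: sq)
    ultimately have "Q g \<le> c\<^sup>2 * Q g'" unfolding Q_def using r01
      by (simp add: distrib_left power_mult_distrib mult_left_mono mult.left_commute)
    moreover have "N g = c powr p * N g'"
    proof -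
      have "\<bar>g x\<bar> powr p = c powr p * \<bar>g' x\<bar> powr p" if "x \<in> S" for x
        using that c by (simp add: abs powr_mult) (simp add: g'_def)
      then show ?thesis unfolding N_def sum_distrib_left by (intro sum.cong) auto
    qed
    then have "N g powr (2 / p) = c\<^sup>2 * N g' powr (2 / p)"
      using c Ng' p by (simp add: powr_mult powr_powr)
    ultimately show ?thesis using * by (simp add: mult_ac)
  qed
  define c where "c = M * N f0 powr (2 / p - 1)"
  define d where "d = (1 - r) * (\<Sum>x\<in>S. w x * f0 x)"
  have c0: "0 < c" using Mpos N0 by (simp add: c_def)
  have d0: "0 < d" using meanpos[OF f0(1)] r01 by (simp add: d_def)
  \<comment> \<open>Only coordinate \<open>i\<close> varies, over all real \<open>v\<close>. As
    \<open>max\<close> covers every sign and every scale, \<open>F\<close> has an unconstrained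
    minimum at \<open>f0 i\<close>, even if \<open>f0 i = 0\<close>.\<close>
  have crit: "c * f0 i powr (p - 1) = d + r * f0 i" if i: "i \<in> S" for i
  proof -
    define C where "C = (\<Sum>x\<in>S - {i}. w x * \<bar>f0 x\<bar> powr p)"
    define D where "D = (\<Sum>x\<in>S - {i}. w x * f0 x)"
    define E where "E = (\<Sum>x\<in>S - {i}. w x * (f0 x)\<^sup>2)"
    have upd: "N (f0(i := v)) = w i * \<bar>v\<bar> powr p + C"
      "(\<Sum>x\<in>S. w x * (f0(i := v)) x) = w i * v + D"
      "Q (f0(i := v)) = (1 - r) * (w i * v + D)\<^sup>2 + r * (w i * v\<^sup>2 + E)" for v
      unfolding N_def Q_def using i S by (auto simp: sum.remove[of S i] C_def D_def E_def intro!: sum.cong)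
    define F where "F = (\<lambda>v. M * (w i * \<bar>v\<bar> powr p + C) powr (2 / p) - ((1 - r) * (w i * v + D)\<^sup>2 + r * (w i * v\<^sup>2 + E)))"
    let ?v = "f0 i"
    have v: "0 \<le> ?v" using Kge f0 i by auto
    have upd0: "N f0 = w i * \<bar>?v\<bar> powr p + C" "(\<Sum>x\<in>S. w x * f0 x) = w i * ?v + D"
      "Q f0 = (1 - r) * (w i * ?v + D)\<^sup>2 + r * (w i * ?v\<^sup>2 + E)"
      using upd[of ?v] by auto
    have "F ?v = 0" unfolding F_def upd0(1)[symmetric] upd0(3)[symmetric] using N0 by (simp add: M_def)
    moreover have "0 \<le> F v" for v unfolding F_def upd(1,3)[symmetric] using max by simp
    moreover have "(F has_real_derivative
      (M * (2 / p * (N f0) powr (2 / p - 1) * (w i * (p * sgn ?v * \<bar>?v\<bar> powr (p - 1))))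
       - ((1 - r) * (2 * (w i * ?v + D) * w i) + r * (w i * (2 * ?v))))) (at ?v)"
    proof -
      define P where "P = (\<lambda>v. w i * \<bar>v\<bar> powr p + C)"
      have PN: "P ?v = N f0" using upd0(1) by (simp add: P_def)
      have pw: "((\<lambda>y. y powr (2 / p)) has_real_derivative 2 / p * N f0 powr (2 / p - 1)) (at (P ?v))"
        unfolding PN by (rule has_real_derivative_powr[OF N0])
      have "(P has_real_derivative (w i * (p * sgn ?v * \<bar>?v\<bar> powr (p - 1)) + 0)) (at ?v)"
        unfolding P_def by (intro DERIV_add DERIV_cmult has_real_derivative_abs_powr p DERIV_const)
      then have "((\<lambda>v. P v powr (2 / p)) has_real_derivative
          2 / p * (N f0) powr (2 / p - 1) * (w i * (p * sgn ?v * \<bar>?v\<bar> powr (p - 1)))) (at ?v)"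
        using DERIV_chain2[of "\<lambda>y. y powr (2 / p)" _ P ?v, OF pw] by (simp only: add_0_right)
      moreover have "((\<lambda>v. (1 - r) * (w i * v + D)\<^sup>2 + r * (w i * v\<^sup>2 + E)) has_real_derivative
          (1 - r) * (2 * (w i * ?v + D) * w i) + r * (w i * (2 * ?v))) (at ?v)"
        by (rule has_real_derivative_quadratic)
      ultimately show ?thesis
        unfolding F_def P_def by (rule DERIV_diff[OF DERIV_cmult])
    qed
    ultimately have "M * (2 / p * (N f0) powr (2 / p - 1) * (w i * (p * sgn ?v * \<bar>?v\<bar> powr (p - 1))))
       - ((1 - r) * (2 * (w i * ?v + D) * w i) + r * (w i * (2 * ?v))) = 0"
      by (intro DERIV_local_min[of F _ ?v 1]) auto
    moreover have "sgn ?v * \<bar>?v\<bar> powr (p - 1) = ?v powr (p - 1)" using v by (auto simp: sgn_if)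
    ultimately have "2 * w i * (c * ?v powr (p - 1)) = 2 * w i * (d + r * ?v)"
      using p unfolding c_def d_def upd0(2) by (simp add: algebra_simps)
    then show ?thesis using wpos[OF i] by simp
  qed
  \<comment> \<open>At a zero of \<open>f0\<close> the critical equation would read
    \<open>0 = d\<close>, but \<open>d\<close> is positive.\<close>
  have f0pos: "0 < f0 i" if "i \<in> S" for i
    using crit[OF that] Kge[OF f0(1) that] d0 c0 by (cases "f0 i = 0") auto
  have three: False if "x \<in> S" "y \<in> S" "z \<in> S" "f0 x < f0 y" "f0 y < f0 z" for x y z
    using powr_affine_three_roots[OF p c0 r01(1) f0pos[OF that(1)] that(4,5) crit crit crit] that by auto
  have "Q f0 \<le> N f0 powr (2 / p)"
  proof -
    obtain x where x: "x \<in> S" using S0 by auto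
    \<comment> \<open>By \<open>three\<close>, \<open>f0\<close> is constant on \<open>B\<close> as
      well as on \<open>A\<close>, and a nonempty set of points has mass at least
      \<open>l\<close>.\<close>
    define A where "A = {z \<in> S. f0 z = f0 x}"
    define B where "B = {z \<in> S. f0 z \<noteq> f0 x}"
    have AB: "S = A \<union> B" "A \<inter> B = {}" "finite A" "finite B" using S by (auto simp: A_def B_def)
    show ?thesis
    proof (cases "B = {}")
      case True
      then have eq: "f0 z = f0 x" if "z \<in> S" for z using that by (auto simp: B_def)
      have "N f0 = f0 x powr p" "(\<Sum>x\<in>S. w x * f0 x) = f0 x" "(\<Sum>x\<in>S. w x * (f0 x)\<^sup>2) = (f0 x)\<^sup>2"
        unfolding N_def using eq w(2) f0pos[OF x] by (simp_all flip: sum_distrib_right)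
      then show ?thesis using f0pos[OF x] p by (simp add: Q_def powr_powr algebra_simps)
    next
      case False
      then obtain y where y: "y \<in> S" "f0 y \<noteq> f0 x" by (auto simp: B_def)
      have B: "f0 z = f0 y" if "z \<in> B" for z
      proof (rule ccontr)
        assume "f0 z \<noteq> f0 y"
        moreover have "f0 z \<noteq> f0 x" "z \<in> S" using that by (auto simp: B_def)
        ultimately show False using three x y by (metis linorder_less_linear)
      qed
      have split: "(\<Sum>z\<in>S. w z * g (f0 z)) = sum w A * g (f0 x) + sum w B * g (f0 y)" for g :: "real \<Rightarrow> real"
      proof -
        have "(\<Sum>z\<in>S. w z * g (f0 z)) = (\<Sum>z\<in>A. w z * g (f0 z)) + (\<Sum>z\<in>B. w z * g (f0 z))"
          using AB by (simp add: sum.union_disjoint)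
        also have "(\<Sum>z\<in>A. w z * g (f0 z)) = sum w A * g (f0 x)"
          unfolding sum_distrib_right by (intro sum.cong) (auto simp: A_def)
        also have "(\<Sum>z\<in>B. w z * g (f0 z)) = sum w B * g (f0 y)"
          unfolding sum_distrib_right using B by (intro sum.cong) auto
        finally show ?thesis .
      qed
      have "w x \<le> sum w A" using x AB(3) wpos by (intro member_le_sum) (auto simp: A_def less_imp_le)
      then have lA: "l \<le> sum w A" using w(1)[OF x] by simp
      have "w y \<le> sum w B" using y AB(4) wpos by (intro member_le_sum) (auto simp: B_def less_imp_le)
      then have lB: "l \<le> sum w B" using w(1)[OF y(1)] by simp
      have "sum w A + sum w B = 1" using split[of "\<lambda>_. 1"] w(2) by simp
      from two_point_inequality[OF p l lA lB this f0pos[OF x] f0pos[OF y(1)] r]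
      show ?thesis unfolding Q_def N_def
        using split[of "\<lambda>v. v"] split[of "\<lambda>v. v\<^sup>2"] split[of "\<lambda>v. \<bar>v\<bar> powr p"] f0pos[OF x] f0pos[OF y(1)] by simp
    qed
  qed
  then have "M \<le> 1" using N0 by (simp add: M_def)
  then have "M * N f powr (2 / p) \<le> N f powr (2 / p)" by (simp add: mult_left_le_one_le Mpos less_imp_le)
  with max[of f] show ?thesis by (simp add: Q_def N_def)
qed

section \<open>Duality with the conjugate exponent, and optimality\<close>

text \<open>Young's inequality, applied pointwise to the normalised functions. If one norm is zero,
  positivity of the weights forces that function to vanish on \<open>S\<close>.\<close>

lemma weighted_Holder:
  fixes w f g :: "'a \<Rightarrow> real"
  assumes pq: "1 < p" "1 < q" "1 / p + 1 / q = 1" and S: "finite S" "\<And>x. x \<in> S \<Longrightarrow> 0 < w x"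
  shows "(\<Sum>x\<in>S. w x * (f x * g x)) \<le>
    (\<Sum>x\<in>S. w x * \<bar>f x\<bar> powr p) powr (1 / p) * (\<Sum>x\<in>S. w x * \<bar>g x\<bar> powr q) powr (1 / q)"
proof -
  define A where "A = (\<Sum>x\<in>S. w x * \<bar>f x\<bar> powr p)"
  define B where "B = (\<Sum>x\<in>S. w x * \<bar>g x\<bar> powr q)"
  have nonneg: "0 \<le> A" "0 \<le> B" using S(2) by (auto simp: A_def B_def less_imp_le intro!: sum_nonneg)
  consider "A = 0" | "B = 0" | "0 < A" "0 < B" using nonneg by linarith
  then have "(\<Sum>x\<in>S. w x * (f x * g x)) \<le> A powr (1 / p) * B powr (1 / q)"
  proof cases
    case 1
    have "f x = 0" if "x \<in> S" for x
    proof -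
      have "\<forall>x\<in>S. w x * \<bar>f x\<bar> powr p = 0"
        using 1 S unfolding A_def by (subst (asm) sum_nonneg_eq_0_iff) (auto simp: less_imp_le)
      then show ?thesis using S(2)[OF that] that by auto
    qed
    then show ?thesis by simp
  next
    case 2
    have "g x = 0" if "x \<in> S" for x
    proof -
      have "\<forall>x\<in>S. w x * \<bar>g x\<bar> powr q = 0"
        using 2 S unfolding B_def by (subst (asm) sum_nonneg_eq_0_iff) (auto simp: less_imp_le)
      then show ?thesis using S(2)[OF that] that by auto
    qed
    then show ?thesis by simp
  next
    case 3
    define F where "F = A powr (1 / p)"
    define G where "G = B powr (1 / q)"
    have FG: "0 < F" "0 < G" using 3 by (auto simp: F_def G_def)
    have FA: "F powr p = A" and GB: "G powr q = B" using 3 pq by (simp_all add: F_def G_def powr_powr)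
    have "w x * (f x * g x) \<le> F * G * (w x * \<bar>f x\<bar> powr p / (A * p) + w x * \<bar>g x\<bar> powr q / (B * q))" if "x \<in> S" for x
    proof -
      have "(\<bar>f x\<bar> / F) * (\<bar>g x\<bar> / G) \<le> (\<bar>f x\<bar> / F) powr p / p + (\<bar>g x\<bar> / G) powr q / q"
        using pq FG by (intro Youngs_inequality) auto
      also have "\<dots> = \<bar>f x\<bar> powr p / (A * p) + \<bar>g x\<bar> powr q / (B * q)"
        using FG by (simp add: powr_divide FA GB)
      finally have *: "\<bar>f x\<bar> * \<bar>g x\<bar> \<le> F * G * (\<bar>f x\<bar> powr p / (A * p) + \<bar>g x\<bar> powr q / (B * q))"
        using FG by (simp add: field_simps)
      have "f x * g x \<le> \<bar>f x\<bar> * \<bar>g x\<bar>" by (metis abs_ge_self abs_mult)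
      then have "f x * g x \<le> F * G * (\<bar>f x\<bar> powr p / (A * p) + \<bar>g x\<bar> powr q / (B * q))"
        using * by linarith
      from mult_left_mono[OF this less_imp_le[OF S(2)[OF that]]]
      show ?thesis by (simp add: algebra_simps)
    qed
    then have "(\<Sum>x\<in>S. w x * (f x * g x)) \<le>
       (\<Sum>x\<in>S. F * G * (w x * \<bar>f x\<bar> powr p / (A * p) + w x * \<bar>g x\<bar> powr q / (B * q)))"
      by (rule sum_mono)
    also have "\<dots> = F * G * (A / (A * p) + B / (B * q))"
      by (simp add: A_def B_def sum.distrib flip: sum_distrib_left sum_divide_distrib)
    also have "\<dots> = F * G" using 3 pq by simp
    finally show ?thesis by (simp add: F_def G_def)
  qed
  then show ?thesis by (simp add: A_def B_def)
qed

text \<open>The operator is self-adjoint with quadratic form \<open>Q\<close>, which the bound into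
  L^2 controls by \<open>(N f)\<^sup>2\<close>. Polarisation bounds the pairing of the image
  \<open>h\<close> of \<open>f\<close> with \<open>g\<close> by \<open>N f * N g\<close>, and the
  \<open>g\<close> dual to \<open>h\<close> recovers the norm of \<open>h\<close> with exponent
  \<open>q\<close>.\<close>

lemma finite_lp_lq_inequality:
  fixes w f :: "'a \<Rightarrow> real"
  assumes p: "1 < p" "p < 2" and q: "q = p / (p - 1)" and S: "finite S" and l: "0 < l" "l < 1 / 2"
    and w: "\<And>x. x \<in> S \<Longrightarrow> l \<le> w x" "sum w S = 1" and r: "r = hyper_const p l"
    and m: "m = (\<Sum>x\<in>S. w x * f x)"
  shows "(\<Sum>x\<in>S. w x * \<bar>m + r * (f x - m)\<bar> powr q) powr (1 / q) \<le>
    (\<Sum>x\<in>S. w x * \<bar>f x\<bar> powr p) powr (1 / p)"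
proof -
  define h where "h = (\<lambda>x. m + r * (f x - m))"
  \<comment> \<open>The Hoelder dual of \<open>h\<close>: pointwise, both \<open>h x * g x\<close>
    and \<open>\<bar>g x\<bar> powr p\<close> equal \<open>\<bar>h x\<bar> powr q\<close>, the
    latter by \<open>(q - 1) * p = q\<close>.\<close>
  define g where "g = (\<lambda>x. sgn (h x) * \<bar>h x\<bar> powr (q - 1))"
  define H where "H = (\<Sum>x\<in>S. w x * \<bar>h x\<bar> powr q)"
  define N where "N = (\<lambda>f. (\<Sum>x\<in>S. w x * \<bar>f x\<bar> powr p) powr (1 / p))"
  define Q where "Q = (\<lambda>f. (1 - r) * (\<Sum>x\<in>S. w x * f x)\<^sup>2 + r * (\<Sum>x\<in>S. w x * (f x)\<^sup>2))"
  have r01: "0 < r" "r < 1" using hyper_const_bounds p l r by auto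
  have wpos: "0 < w x" if "x \<in> S" for x using w l that by force
  have q1: "1 < q" "(q - 1) * p = q" "1 - 1 / p = 1 / q" using p by (auto simp: q field_simps)
  have QN: "Q f \<le> (N f)\<^sup>2" for f
  proof -
    have "Q f \<le> (\<Sum>x\<in>S. w x * \<bar>f x\<bar> powr p) powr (2 / p)"
      unfolding Q_def by (rule finite_lp_l2_inequality[OF p S l w r])
    also have "\<dots> = (N f)\<^sup>2"
      by (simp add: N_def power2_eq_square flip: powr_add)
    finally show ?thesis .
  qed
  have Nnn: "0 \<le> N f" for f by (simp add: N_def)
  show ?thesis
  proof (cases "H = 0")
    case True
    then show ?thesis using Nnn[of f] q1 by (simp add: H_def h_def N_def)
  next
    case False
    have "0 \<le> H" using wpos by (auto simp: H_def less_imp_le intro!: sum_nonneg)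
    with False have H: "0 < H" by simp
    have NgH: "N g = H powr (1 / p)"
    proof -
      have "\<bar>g x\<bar> powr p = \<bar>h x\<bar> powr q" for x
        using p q1 by (cases "h x = 0") (auto simp: g_def abs_mult powr_powr abs_sgn_eq)
      then show ?thesis by (simp add: N_def H_def)
    qed
    then have Ng: "0 < N g" using H by simp
    have Nf: "0 < N f"
    proof (rule ccontr)
      assume "\<not> 0 < N f"
      then have "(\<Sum>x\<in>S. w x * \<bar>f x\<bar> powr p) = 0" using Nnn[of f] by (simp add: N_def)
      then have "\<forall>x\<in>S. w x * \<bar>f x\<bar> powr p = 0"
        using S wpos by (subst (asm) sum_nonneg_eq_0_iff) (auto simp: less_imp_le)
      then have f: "\<forall>x\<in>S. f x = 0" using wpos by force
      then have "m = 0" by (simp add: m)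
      with f have "H = 0" using q1 by (simp add: H_def h_def)
      with H show False by simp
    qed
    \<comment> \<open>\<open>H\<close> is the bilinear form of \<open>Q\<close> at \<open>(f, g)\<close>; normalising makes \<open>Q u \<ge> 0\<close> replace Cauchy--Schwarz.\<close>
    define u where "u = (\<lambda>x. f x / N f - g x / N g)"
    have Hform: "H = (1 - r) * m * (\<Sum>x\<in>S. w x * g x) + r * (\<Sum>x\<in>S. w x * (f x * g x))"
    proof -
      have "\<bar>h x\<bar> powr q = h x * g x" for x
      proof -
        have "h x * g x = \<bar>h x\<bar> * \<bar>h x\<bar> powr (q - 1)" by (simp add: g_def abs_sgn mult_ac)
        also have "\<dots> = \<bar>h x\<bar> powr q" by (cases "h x = 0") (auto simp: powr_diff)
        finally show ?thesis by simp
      qed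
      then have "H = (\<Sum>x\<in>S. w x * (h x * g x))" by (simp add: H_def)
      also have "\<dots> = (\<Sum>x\<in>S. (1 - r) * m * (w x * g x) + r * (w x * (f x * g x)))"
        by (intro sum.cong) (auto simp: h_def algebra_simps)
      finally show ?thesis by (simp add: sum.distrib sum_distrib_left)
    qed
    have "0 \<le> Q u" unfolding Q_def using r01 wpos
      by (auto intro!: add_nonneg_nonneg mult_nonneg_nonneg sum_nonneg simp: less_imp_le)
    also have "Q u = Q f / (N f)\<^sup>2 - 2 * H / (N f * N g) + Q g / (N g)\<^sup>2"
    proof -
      have 1: "(\<Sum>x\<in>S. w x * u x) = m / N f - (\<Sum>x\<in>S. w x * g x) / N g"
        by (simp add: u_def m right_diff_distrib sum_subtractf sum_divide_distrib)
      have "(\<Sum>x\<in>S. w x * (u x)\<^sup>2) = (\<Sum>x\<in>S. w x * (f x)\<^sup>2 / (N f)\<^sup>2 - 2 * (w x * (f x * g x)) / (N f * N g) + w x * (g x)\<^sup>2 / (N g)\<^sup>2)"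
        using Nf Ng by (intro sum.cong refl) (simp add: u_def power2_eq_square field_simps)
      also have "\<dots> = (\<Sum>x\<in>S. w x * (f x)\<^sup>2) / (N f)\<^sup>2 - 2 * (\<Sum>x\<in>S. w x * (f x * g x)) / (N f * N g) + (\<Sum>x\<in>S. w x * (g x)\<^sup>2) / (N g)\<^sup>2"
        by (simp add: sum.distrib sum_subtractf sum_divide_distrib sum_distrib_left)
      finally have 2: "(\<Sum>x\<in>S. w x * (u x)\<^sup>2) = \<dots>" .
      show ?thesis unfolding Q_def 1 2 Hform m[symmetric] using Nf Ng by (simp add: power2_eq_square field_simps)
    qed
    also have "\<dots> \<le> 1 - 2 * H / (N f * N g) + 1"
      using QN[of f] QN[of g] Nf Ng by (intro add_mono diff_mono) auto
    finally have "H \<le> N f * N g" using Nf Ng by (simp add: field_simps)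
    then have "H / H powr (1 / p) \<le> N f" using Ng NgH by (simp add: pos_divide_le_eq)
    moreover have "H / H powr (1 / p) = H powr (1 / q)"
      using H by (simp add: powr_diff flip: q1(3))
    ultimately show ?thesis by (simp add: H_def h_def N_def)
  qed
qed

text \<open>Choose \<open>\<rho>\<close> so that \<open>1 + \<rho> * X\<close> is proportional to
  the nonconstant function with equality in the two-point inequality. Pairing it with
  \<open>1 + r * \<rho> * X\<close>, Hoelder and the hypothesis give
  \<open>1 + r * (\<rho>\<^sup>2 * (a * l)) \<le> N * N\<close>, and equality evaluates
  \<open>N * N\<close> as the same expression with the sharp constant in place of
  \<open>r\<close>.\<close>

lemma hyper_const_optimal:
  fixes w X :: "'a \<Rightarrow> real"
  assumes p: "1 < p" "p < 2" and q: "q = p / (p - 1)" and S: "finite S" and l: "0 < l" "l < 1 / 2"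
    and w: "\<And>x. x \<in> S \<Longrightarrow> l \<le> w x" "sum w S = 1" and x0: "x0 \<in> S" "w x0 = l"
    and X: "\<And>x. x \<in> S \<Longrightarrow> X x = (if x = x0 then 1 - l else - l)"
    and ineq: "\<And>\<rho>. (\<Sum>x\<in>S. w x * \<bar>1 + r * \<rho> * X x\<bar> powr q) powr (1 / q) \<le>
      (\<Sum>x\<in>S. w x * \<bar>1 + \<rho> * X x\<bar> powr p) powr (1 / p)"
  shows "r \<le> hyper_const p l"
proof -
  have wpos: "0 < w x" if "x \<in> S" for x using w l that by force
  have q1: "1 < q" "1 / p + 1 / q = 1" using p by (auto simp: q field_simps)
  have sumX: "(\<Sum>x\<in>S. w x * g (X x)) = l * g (1 - l) + (1 - l) * g (- l)" for g
  proof -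
    have "(\<Sum>x\<in>S. w x * g (X x)) = l * g (1 - l) + (\<Sum>x\<in>S - {x0}. w x * g (X x))"
      using S x0 X by (simp add: sum.remove[of S x0])
    also have "(\<Sum>x\<in>S - {x0}. w x * g (X x)) = sum w (S - {x0}) * g (- l)"
      unfolding sum_distrib_right using X by (intro sum.cong) auto
    also have "sum w (S - {x0}) = 1 - l" using w(2) S x0 by (simp add: sum_diff1)
    finally show ?thesis .
  qed
  define a where "a = 1 - l"
  have a: "l < a" "a + l = 1" "0 < a" using l by (auto simp: a_def)
  define x where "x = (l / a) powr (1 / p)"
  define y where "y = (a / l) powr (1 / p)"
  have "l / a < a / l" using a l by (simp add: field_simps mult_strict_mono)
  then have xy: "0 < x" "x < y" using a l p by (auto simp: x_def y_def intro!: powr_less_mono2)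
  note eq = two_point_equality[OF p(1) l(1) a(1,2), folded x_def y_def]
  define m where "m = a * x + l * y"
  have m: "0 < m" using a l xy by (simp add: m_def add_pos_pos)
  \<comment> \<open>Dividing the extremal function by its mean \<open>m\<close> gives the values
    \<open>y / m\<close> at \<open>x0\<close> and \<open>x / m\<close> elsewhere; as
    \<open>X\<close> is centred with jump 1, \<open>\<rho>\<close> is their difference.\<close>
  define \<rho> where "\<rho> = (y - x) / m"
  have f1: "1 + \<rho> * (1 - l) = y / m" and f2: "1 + \<rho> * (- l) = x / m"
    using m unfolding \<rho>_def by (simp_all add: field_simps) (simp_all add: m_def a_def algebra_simps)
  define N where "N = (\<Sum>x\<in>S. w x * \<bar>1 + \<rho> * X x\<bar> powr p) powr (1 / p)"
  have N: "N = 1 / m"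
  proof -
    have "(\<Sum>x\<in>S. w x * \<bar>1 + \<rho> * X x\<bar> powr p) = l * (y / m) powr p + a * (x / m) powr p"
      using sumX[of "\<lambda>v. \<bar>1 + \<rho> * v\<bar> powr p"] m xy unfolding f1 f2 a_def by simp
    also have "\<dots> = (1 / m) powr p * (a * x powr p + l * y powr p)"
      using m xy by (simp add: powr_divide field_simps)
    also have "\<dots> = (1 / m) powr p" using eq(2) by simp
    finally show ?thesis unfolding N_def using m p by (simp add: powr_powr)
  qed
  \<comment> \<open>\<open>X\<close> has mean 0 and second moment \<open>a * l\<close>.\<close>
  have "1 + r * (\<rho>\<^sup>2 * (a * l)) = (\<Sum>x\<in>S. w x * ((1 + r * \<rho> * X x) * (1 + \<rho> * X x)))"
    using sumX[of "\<lambda>v. (1 + r * \<rho> * v) * (1 + \<rho> * v)"]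
    by (simp add: a_def algebra_simps power2_eq_square)
  also have "\<dots> \<le> (\<Sum>x\<in>S. w x * \<bar>1 + r * \<rho> * X x\<bar> powr q) powr (1 / q) * N"
    unfolding N_def by (rule weighted_Holder) (use p q1 S wpos in \<open>auto simp: add.commute\<close>)
  also have "\<dots> \<le> N * N" unfolding N_def using ineq by (intro mult_right_mono) auto
  \<comment> \<open>This is the equality case, written as squared mean plus the constant times the
    variance, divided by \<open>m\<^sup>2\<close>.\<close>
  also have "\<dots> = 1 + hyper_const p l * (\<rho>\<^sup>2 * (a * l))"
  proof -
    have "m\<^sup>2 + hyper_const p l * (a * l * (y - x)\<^sup>2) = 1"
    proof -
      have "m\<^sup>2 + hyper_const p l * (a * l * (y - x)\<^sup>2) =
          (1 - hyper_const p l) * (a * x + l * y)\<^sup>2 + hyper_const p l * (a * x\<^sup>2 + l * y\<^sup>2)"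
        unfolding m_def a_def by (simp add: algebra_simps power2_eq_square)
      with eq(1) show ?thesis by simp
    qed
    then have "1 / m\<^sup>2 = (m\<^sup>2 + hyper_const p l * (a * l * (y - x)\<^sup>2)) / m\<^sup>2" by simp
    also have "\<dots> = 1 + hyper_const p l * (\<rho>\<^sup>2 * (a * l))"
      using m by (simp add: \<rho>_def add_divide_distrib power_divide mult_ac)
    finally show ?thesis by (simp add: N power2_eq_square)
  qed
  finally have "r * (\<rho>\<^sup>2 * (a * l)) \<le> hyper_const p l * (\<rho>\<^sup>2 * (a * l))" by simp
  moreover have "0 < \<rho>\<^sup>2 * (a * l)" using xy m a l by (simp add: \<rho>_def)
  ultimately show ?thesis by (simp only: mult_le_cancel_right_pos)
qed

section \<open>Passage to finite probability measures\<close>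

text \<open>Null points are left out of the sum so that every remaining weight is at least the least
  atom mass, as the finite inequalities demand.\<close>

lemma integral_discrete:
  fixes f :: "'a \<Rightarrow> real"
  assumes M: "prob_space M" "finite (space M)" "sets M = Pow (space M)"
  shows "(\<integral>x. f x \<partial>M) = (\<Sum>x | x \<in> space M \<and> 0 < measure M {x}. measure M {x} * f x)"
proof -
  interpret prob_space M by (rule M(1))
  have "M = point_measure (space M) (\<lambda>x. measure M {x})"
    by (rule measure_eqI_finite[of _ "space M"])
      (use M in \<open>auto simp: sets_point_measure emeasure_point_measure_finite emeasure_eq_measure\<close>)
  then have "(\<integral>x. f x \<partial>M) = (\<integral>x. f x \<partial>point_measure (space M) (\<lambda>x. measure M {x}))" by simp
  also have "\<dots> = (\<Sum>x\<in>space M. measure M {x} * f x)"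
    using M(2) by (subst lebesgue_integral_point_measure_finite) auto
  also have "\<dots> = (\<Sum>x | x \<in> space M \<and> 0 < measure M {x}. measure M {x} * f x)"
    using M(2) by (intro sum.mono_neutral_right) (auto simp: zero_less_measure_iff)
  finally show ?thesis .
qed

lemma lp_space_discrete:
  assumes M: "prob_space M" "finite (space M)" "sets M = Pow (space M)"
  shows "f \<in> lp_space M p"
proof -
  interpret prob_space M by (rule M(1))
  have meas: "g \<in> borel_measurable M" for g :: "'a \<Rightarrow> real"
    by (rule measurableI) (use M(3) in auto)
  have "integrable M (\<lambda>x. \<bar>f x\<bar> powr p)"
    using M(2) meas
    by (intro integrable_const_bound[of _ "\<Sum>x\<in>space M. \<bar>f x\<bar> powr p"] AE_I2) (auto intro!: member_le_sum)
  with meas show ?thesis by (simp add: lp_space_def)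
qed

lemma least_atom_mass_eqD:
  assumes M: "prob_space M" "finite (space M)" "sets M = Pow (space M)"
    and l: "least_atom_mass M = l"
  shows "(\<Sum>x | x \<in> space M \<and> 0 < measure M {x}. measure M {x}) = 1"
    and "x \<in> space M \<Longrightarrow> 0 < measure M {x} \<Longrightarrow> l \<le> measure M {x}"
    and "\<exists>x\<in>space M. 0 < measure M {x} \<and> measure M {x} = l"
proof -
  interpret prob_space M by (rule M(1))
  let ?S = "{x \<in> space M. 0 < measure M {x}}"
  show one: "sum (\<lambda>x. measure M {x}) ?S = 1"
    using integral_discrete[OF M, of "\<lambda>_. 1"] by (simp add: prob_space)
  have eq: "{measure M {x} | x. x \<in> space M \<and> 0 < measure M {x}} = (\<lambda>x. measure M {x}) ` ?S"
    by auto
  have fin: "finite ((\<lambda>x. measure M {x}) ` ?S)" using M(2) by auto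
  have "?S \<noteq> {}" using one by force
  then have "Min ((\<lambda>x. measure M {x}) ` ?S) \<in> (\<lambda>x. measure M {x}) ` ?S"
    using fin by (intro Min_in) auto
  then show "\<exists>x\<in>space M. 0 < measure M {x} \<and> measure M {x} = l"
    using l unfolding least_atom_mass_def eq by auto
  show "l \<le> measure M {x}" if "x \<in> space M" "0 < measure M {x}"
    using fin that unfolding l[symmetric] least_atom_mass_def eq by (intro Min_le) auto
qed

lemma lp_norm_scale: "lp_norm M p (\<lambda>x. c * f x) = \<bar>c\<bar> * lp_norm M p f" if "p \<noteq> 0"
  using that by (simp add: lp_norm_def abs_mult powr_mult powr_powr)

lemma noise_contraction:
  fixes M :: "'a measure"
  assumes M: "prob_space M" "finite (space M)" "sets M = Pow (space M)"
    and l: "least_atom_mass M = l" "0 < l" "l < 1 / 2" and p: "1 < p" "p < 2" and q: "q = p / (p - 1)"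
  shows "lp_norm M q (noise_op M (hyper_const p l) f) \<le> lp_norm M p f"
  using least_atom_mass_eqD[OF M l(1)] l M(2)
  unfolding lp_norm_def noise_op_def expect_op_def integral_discrete[OF M]
  by (intro finite_lp_lq_inequality[OF p q]) auto

text \<open>The hypothesis speaks only of the functions \<open>1 + \<rho> * X\<close>, so that it
  can be supplied both by an operator norm bound and by the condition defining
  \<open>sigma_rv\<close>.\<close>

lemma noise_contraction_optimal:
  fixes M :: "'a measure"
  assumes M: "prob_space M" "finite (space M)" "sets M = Pow (space M)"
    and l: "least_atom_mass M = l" "0 < l" "l < 1 / 2" and p: "1 < p" "p < 2" and q: "q = p / (p - 1)"
    and x0: "x0 \<in> space M" "measure M {x0} = l"
    and X: "\<And>x. x \<in> space M \<Longrightarrow> X x = (if x = x0 then 1 - l else - l)"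
    and ineq: "\<And>\<rho>. lp_norm M q (\<lambda>x. 1 + r * \<rho> * X x) \<le> lp_norm M p (\<lambda>x. 1 + \<rho> * X x)"
  shows "r \<le> hyper_const p l"
proof (rule hyper_const_optimal[OF p q _ l(2,3)])
  let ?S = "{x \<in> space M. 0 < measure M {x}}"
  show "finite ?S" using M(2) by simp
  show "l \<le> measure M {x}" if "x \<in> ?S" for x using least_atom_mass_eqD(2)[OF M l(1)] that by auto
  show "(\<Sum>x\<in>?S. measure M {x}) = 1" by (rule least_atom_mass_eqD(1)[OF M l(1)])
  show "x0 \<in> ?S" "measure M {x0} = l" using x0 l(2) by auto
  show "X x = (if x = x0 then 1 - l else - l)" if "x \<in> ?S" for x using X that by auto
  show "(\<Sum>x\<in>?S. measure M {x} * \<bar>1 + r * \<rho> * X x\<bar> powr q) powr (1 / q) \<le>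
      (\<Sum>x\<in>?S. measure M {x} * \<bar>1 + \<rho> * X x\<bar> powr p) powr (1 / p)" for \<rho>
    using ineq[of \<rho>] unfolding lp_norm_def integral_discrete[OF M] .
qed

lemma expectation_atom_indicator:
  fixes M :: "'a measure"
  assumes M: "prob_space M" "finite (space M)" "sets M = Pow (space M)"
    and x0: "x0 \<in> space M" "measure M {x0} = l"
    and X: "\<And>x. x \<in> space M \<Longrightarrow> X x = (if x = x0 then 1 - l else - l)"
  shows "(\<integral>x. 1 + \<rho> * X x \<partial>M) = 1"
proof -
  interpret prob_space M by (rule M(1))
  have "(\<integral>x. 1 + \<rho> * X x \<partial>M) = (\<integral>x. (1 - \<rho> * l) + \<rho> * indicator {x0} x \<partial>M)"
    by (rule Bochner_Integration.integral_cong) (use X in \<open>auto simp: algebra_simps\<close>)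
  also have "\<dots> = (1 - \<rho> * l) + \<rho> * measure M {x0}"
    using x0 M(3) by (subst Bochner_Integration.integral_add)
      (auto simp: prob_space emeasure_eq_measure less_top[symmetric] intro!: integrable_real_indicator)
  finally show ?thesis using x0 by simp
qed

section \<open>Evaluation of the two sharp constants\<close>

text \<open>Admissibility is the contraction property. Conversely, an admissible \<open>r\<close> is
  tested on \<open>1 + \<rho> * X\<close>, with \<open>X\<close> the centred indicator of an atom of
  mass \<open>l\<close>: this function has mean 1, so the noise operator sends it to
  \<open>1 + r * \<rho> * X\<close>.\<close>

lemma sigma_measure_eq:
  fixes M :: "'a measure"
  assumes M: "prob_space M" "finite (space M)" "sets M = Pow (space M)"
    and l: "least_atom_mass M = l" "0 < l" "l < 1 / 2" and p: "1 < p" "p < 2" and q: "q = p / (p - 1)"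
  shows "sigma_measure p q M = hyper_const p l"
  unfolding sigma_measure_def
proof (rule Greatest_equality)
  have "lp_lq_opnorm M p q (noise_op M (hyper_const p l)) \<le> 1"
    unfolding lp_lq_opnorm_def
  proof (rule SUP_least)
    fix f assume "f \<in> {f \<in> lp_space M p. lp_norm M p f \<le> 1}"
    with noise_contraction[OF M l p q, of f] show "ereal (lp_norm M q (noise_op M (hyper_const p l) f)) \<le> 1"
      by (simp add: one_ereal_def)
  qed
  then show "0 < hyper_const p l \<and> hyper_const p l < 1 \<and> lp_lq_opnorm M p q (noise_op M (hyper_const p l)) \<le> 1"
    using hyper_const_bounds p l by simp
next
  fix r assume r: "0 < r \<and> r < 1 \<and> lp_lq_opnorm M p q (noise_op M r) \<le> 1"
  have q0: "q \<noteq> 0" using p q by simp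
  obtain x0 where x0: "x0 \<in> space M" "measure M {x0} = l"
    using least_atom_mass_eqD(3)[OF M l(1)] by auto
  define X where "X = (\<lambda>x. if x = x0 then 1 - l else - l)"
  show "r \<le> hyper_const p l"
  proof (rule noise_contraction_optimal[OF M l p q x0, of X])
    show "X x = (if x = x0 then 1 - l else - l)" for x by (simp add: X_def)
    fix \<rho>
    define f where "f = (\<lambda>x. 1 + \<rho> * X x)"
    define c where "c = lp_norm M p f"
    have mean: "(\<integral>x. f x \<partial>M) = 1"
      unfolding f_def by (rule expectation_atom_indicator[OF M x0]) (simp add: X_def)
    have noise: "noise_op M r (\<lambda>x. k * f x) = (\<lambda>x. k * (1 + r * \<rho> * X x))" for k
      using mean by (auto simp: noise_op_def expect_op_def) (simp add: f_def algebra_simps)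
    have c0: "0 \<le> c" by (simp add: c_def lp_norm_def)
    \<comment> \<open>A zero norm would make \<open>f\<close> vanish at every atom, against its mean
      1. Hence \<open>f\<close> can be scaled into the unit ball.\<close>
    have c: "0 < c"
    proof (rule ccontr)
      assume "\<not> 0 < c"
      with c0 have "c = 0" by simp
      then have "(\<Sum>x | x \<in> space M \<and> 0 < measure M {x}. measure M {x} * \<bar>f x\<bar> powr p) = 0"
        by (simp add: c_def lp_norm_def integral_discrete[OF M])
      then have "\<forall>x\<in>{x \<in> space M. 0 < measure M {x}}. measure M {x} * \<bar>f x\<bar> powr p = 0"
        using M(2) by (subst (asm) sum_nonneg_eq_0_iff) auto
      then have "(\<integral>x. f x \<partial>M) = 0"
        unfolding integral_discrete[OF M] by (intro sum.neutral) auto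
      with mean show False by simp
    qed
    have "lp_norm M p (\<lambda>x. (1 / c) * f x) \<le> 1"
      using p c by (subst lp_norm_scale) (auto simp: c_def[symmetric])
    then have "ereal (lp_norm M q (noise_op M r (\<lambda>x. (1 / c) * f x))) \<le> lp_lq_opnorm M p q (noise_op M r)"
      unfolding lp_lq_opnorm_def using lp_space_discrete[OF M] by (intro SUP_upper) auto
    also have "\<dots> \<le> 1" using r by simp
    finally have "lp_norm M q (noise_op M r (\<lambda>x. (1 / c) * f x)) \<le> 1" by (simp add: one_ereal_def)
    then have "(1 / c) * lp_norm M q (\<lambda>x. 1 + r * \<rho> * X x) \<le> 1"
      unfolding noise using q0 c by (subst (asm) lp_norm_scale) auto
    then show "lp_norm M q (\<lambda>x. 1 + r * \<rho> * X x) \<le> lp_norm M p (\<lambda>x. 1 + \<rho> * X x)"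
      using c by (simp add: field_simps c_def f_def)
  qed
qed

text \<open>The Bernoulli law is itself a finite probability measure whose least atom is
  \<open>True\<close>, of mass \<open>l < 1 / 2\<close>, and \<open>two_point_rv l\<close> is the
  centred indicator of that atom. The contraction and its optimality thus apply on
  \<open>bool\<close>.\<close>

lemma sigma_two_point_eq:
  fixes l p q :: real
  assumes l: "0 < l" "l < 1 / 2" and p: "1 < p" "p < 2" and q: "q = p / (p - 1)"
  shows "sigma_two_point p q l = hyper_const p l"
proof -
  define M where "M = measure_pmf (bernoulli_pmf l)"
  have M: "prob_space M" "finite (space M)" "sets M = Pow (space M)"
    by (auto simp: M_def measure_pmf.prob_space_axioms)
  have mass: "measure M {True} = l" "measure M {False} = 1 - l"
    using l by (simp_all add: M_def measure_pmf_single)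
  have "{measure M {x} | x. x \<in> space M \<and> 0 < measure M {x}} = {l, 1 - l}"
  proof -
    have "space M = UNIV" by (simp add: M_def)
    then show ?thesis using l mass by (force simp: UNIV_bool ex_bool_eq)
  qed
  then have lam: "least_atom_mass M = l" using l by (simp add: least_atom_mass_def)
  have x0: "True \<in> space M" "measure M {True} = l" using mass by (auto simp: M_def)
  have X: "two_point_rv l x = (if x = True then 1 - l else - l)" for x by (simp add: two_point_rv_def)
  show ?thesis
    unfolding sigma_two_point_def sigma_rv_def M_def[symmetric]
  proof (rule Greatest_equality)
    show "\<forall>\<rho>. lp_norm M q (\<lambda>x. 1 + hyper_const p l * \<rho> * two_point_rv l x) \<le> lp_norm M p (\<lambda>x. 1 + \<rho> * two_point_rv l x)"
    proof
      fix \<rho>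
      have "noise_op M (hyper_const p l) (\<lambda>x. 1 + \<rho> * two_point_rv l x) = (\<lambda>x. 1 + hyper_const p l * \<rho> * two_point_rv l x)"
        unfolding noise_op_def expect_op_def expectation_atom_indicator[OF M x0 X] by (simp add: mult.assoc)
      with noise_contraction[OF M lam l p q, of "\<lambda>x. 1 + \<rho> * two_point_rv l x"]
      show "lp_norm M q (\<lambda>x. 1 + hyper_const p l * \<rho> * two_point_rv l x) \<le> lp_norm M p (\<lambda>x. 1 + \<rho> * two_point_rv l x)"
        by simp
    qed
  next
    fix r assume "\<forall>\<rho>. lp_norm M q (\<lambda>x. 1 + r * \<rho> * two_point_rv l x) \<le> lp_norm M p (\<lambda>x. 1 + \<rho> * two_point_rv l x)"
    then show "r \<le> hyper_const p l"
      by (intro noise_contraction_optimal[OF M lam l p q x0 X]) auto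
  qed
qed

theorem corollary1p7:
  fixes \<mu> :: "'a measure" and l p pstar :: real
  assumes "prob_space \<mu>"
    and "finite (space \<mu>)"
    and "sets \<mu> = Pow (space \<mu>)"
    and "least_atom_mass \<mu> = l"
    and "0 < l" and "l < 1 / 2"
    and "1 < p" and "p < 2"
    and "pstar = p / (p - 1)"
  shows "sigma_measure p pstar \<mu> = sigma_two_point p pstar l \<and>
    sigma_two_point p pstar l =
      sinh (1 / pstar * ln ((1 - l) / l)) / sinh (1 / p * ln ((1 - l) / l))"
proof -
  have "1 - 1 / p = 1 / pstar" unfolding assms(9) using assms(7) by (simp add: field_simps)
  then show ?thesis
    using sigma_measure_eq[OF assms] sigma_two_point_eq[OF assms(5-9)] by (simp add: hyper_const_def)
qed

end
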